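(* Consider a GBSM instance and a partial solution $(S',X')$ as in the context, let $\epsilon\in(0,1)$, and let $L$ be the list returned by Algorithm 2 (described in the context) on input $S,X,S',X',k,\epsilon$. Then $L$ is a $\left(1-\frac1e\right)(1-\epsilon)$-list with respect to $(S',X')$.
   Context: GBSM: Let $X$ be a finite set of $n$ elements and $S$ a finite set of $m$ bins. Each bin $s\in S$ has a cost $c(s)\in\mathbb{R}_{\ge0}$, and for each $s\in S$, $x\in X$ there is a cost $c(s,x)\ge 0$ of associating $x$ to $s$. Let $k\in\mathbb{R}_{\ge0}$ be a budget and $f:2^X\to\mathbb{R}_{\ge0}$ a monotone nondecreasing submodular function. For $S'\subseteq S$, $X'\subseteq X$ let $c(S',X')=\sum_{s\in S'}c(s)+\sum_{x\in X'}\min_{s\in S'}c(s,x)$. For a partial solution $(S',X')$: $c_{S'}(s)=c(s)$ if $s\notin S'$ and $c_{S'}(s)=0$ if $s\in S'$; for $T\subseteq X\setminus X'$, $c_{\min}(T)=\min_{s\in S}\{c_{S'}(s)+\sum_{x\in T}c(s,x)\}$, $s_{\min}(T)$ is a bin attaining this minimum, and $g(T)=f(X'\cup T)-f(X')$. Let $\mathcal F=\{T\subseteq X\setminus X' : c(S'\cup\{s_{\min}(T)\},T)\le k\}$. A family $L\subseteq\mathcal F$ is an $\alpha$-list with respect to $(S',X')$ if $\max\{g(T)/c_{\min}(T): T\in L, c_{\min}(T)>0\}\ge \alpha\max\{g(T)/c_{\min}(T): T\in\mathcal F, c_{\min}(T)>0\}$. Standing assumption: partial solutions considered satisfy $c_{\min}(T)>0$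 for every $T\in\mathcal F$. Let $\hat c=\min\{\min\{c(s): s\in S, c(s)>0\},\ \min\{c(s,x): s\in S, x\in X, c(s,x)>0\}\}$. $\mathtt{GreedyMaxCover}(X,s,B)$ denotes a procedure returning a set $T\subseteq X$ with $\sum_{x\in T}c(s,x)\le B$ and $g(T)\ge(1-\frac1e)\max\{g(T'): T'\subseteq X, \sum_{x\in T'}c(s,x)\le B\}$ (a $(1-1/e)$-approximation for maximizing the monotone submodular $g$ under the knapsack constraint with element costs $c(s,\cdot)$). Algorithm 2: $L:=\emptyset$. For each $s\in S$: set $i:=0$; while $\hat c(1+\epsilon)^i<k$: let $B_i:=\hat c(1+\epsilon)^i$, $T_i(s):=\mathtt{GreedyMaxCover}(X,s,B_i-c_{S'}(s))$, $L:=L\cup\{T_i(s)\}$, $i:=i+1$; after the loop, let $B_i:=k$, $T_i(s):=\mathtt{GreedyMaxCover}(X,s,B_i-c_{S'}(s))$, $L:=L\cup\{T_i(s)\}$. Return $L$.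
   Formalization: L ⊆ F can fail if the bins of S' have positive cost; so L ⊆ F is claimed only when c(S')=0, otherwise with budget k+c(S'). The ratio bound is kept for all S'. GreedyMaxCover returns sets avoiding X', none for negative budgets; positivity is assumed for nonempty T; an empty maximum is 0. *)

theory Defs
  imports Complex_Main "HOL-Library.While_Combinator"
begin

text \<open>
  Conventions: \<open>X\<close> is the ground set, \<open>S\<close> the set of bins, \<open>c s\<close> the cost of bin \<open>s\<close>, \<open>d s x\<close> the
  cost of associating \<open>x\<close> to \<open>s\<close>, \<open>k\<close> the budget, \<open>f\<close> the objective (relevant on subsets of \<open>X\<close>
  only), and \<open>(S', X')\<close> the partial solution.
\<close>

definition gbsm ::
    "'x set \<Rightarrow> 's set \<Rightarrow> ('s \<Rightarrow> real) \<Rightarrow> ('s \<Rightarrow> 'x \<Rightarrow> real) \<Rightarrow> real \<Rightarrow> ('x set \<Rightarrow> real) \<Rightarrow> bool" where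
  "gbsm X S c d k f \<longleftrightarrow>
     finite X \<and> finite S \<and>
     (\<forall>s\<in>S. c s \<ge> 0) \<and> (\<forall>s\<in>S. \<forall>x\<in>X. d s x \<ge> 0) \<and> k \<ge> 0 \<and>
     (\<forall>A. A \<subseteq> X \<longrightarrow> f A \<ge> 0) \<and>
     (\<forall>A B. A \<subseteq> B \<and> B \<subseteq> X \<longrightarrow> f A \<le> f B) \<and>
     (\<forall>A B. A \<subseteq> X \<and> B \<subseteq> X \<longrightarrow> f (A \<union> B) + f (A \<inter> B) \<le> f A + f B)"

definition total_cost :: "('s \<Rightarrow> real) \<Rightarrow> ('s \<Rightarrow> 'x \<Rightarrow> real) \<Rightarrow> 's set \<Rightarrow> 'x set \<Rightarrow> real" where
  "total_cost c d A T = (\<Sum>s\<in>A. c s) + (\<Sum>x\<in>T. Min ((\<lambda>s. d s x) ` A))"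

definition open_cost :: "('s \<Rightarrow> real) \<Rightarrow> 's set \<Rightarrow> 's \<Rightarrow> real" where
  "open_cost c S' s = (if s \<in> S' then 0 else c s)"

definition add_cost :: "('s \<Rightarrow> real) \<Rightarrow> ('s \<Rightarrow> 'x \<Rightarrow> real) \<Rightarrow> 's set \<Rightarrow> 's \<Rightarrow> 'x set \<Rightarrow> real" where
  "add_cost c d S' s T = open_cost c S' s + (\<Sum>x\<in>T. d s x)"

definition c_min ::
    "'s set \<Rightarrow> ('s \<Rightarrow> real) \<Rightarrow> ('s \<Rightarrow> 'x \<Rightarrow> real) \<Rightarrow> 's set \<Rightarrow> 'x set \<Rightarrow> real" where
  "c_min S c d S' T = Min ((\<lambda>s. add_cost c d S' s T) ` S)"

text \<open>\<open>s_min\<close> is an arbitrary selection of minimising bins (ties may be broken in any way); its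
  existence makes \<open>S\<close> nonempty.\<close>

definition is_s_min ::
    "'x set \<Rightarrow> 's set \<Rightarrow> ('s \<Rightarrow> real) \<Rightarrow> ('s \<Rightarrow> 'x \<Rightarrow> real) \<Rightarrow> 's set \<Rightarrow> 'x set \<Rightarrow> ('x set \<Rightarrow> 's) \<Rightarrow> bool"
  where
  "is_s_min X S c d S' X' s_min \<longleftrightarrow>
     (\<forall>T. T \<subseteq> X - X' \<longrightarrow> s_min T \<in> S \<and> add_cost c d S' (s_min T) T = c_min S c d S' T)"

definition gain :: "('x set \<Rightarrow> real) \<Rightarrow> 'x set \<Rightarrow> 'x set \<Rightarrow> real" where
  "gain f X' T = f (X' \<union> T) - f X'"

text \<open>The family \<open>\<F>\<close> for a budget \<open>b\<close>; note that the cost includes the costs of all bins in \<open>S'\<close>.\<close>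

definition feasible ::
    "'x set \<Rightarrow> ('s \<Rightarrow> real) \<Rightarrow> ('s \<Rightarrow> 'x \<Rightarrow> real) \<Rightarrow> 's set \<Rightarrow> 'x set \<Rightarrow> ('x set \<Rightarrow> 's) \<Rightarrow> real \<Rightarrow> 'x set set"
  where
  "feasible X c d S' X' s_min b =
     {T. T \<subseteq> X - X' \<and> total_cost c d (S' \<union> {s_min T}) T \<le> b}"

text \<open>The ratios are nonnegative, so inserting 0 has no effect except that the maximum over the
  empty set becomes 0.\<close>

definition max_ratio ::
    "'s set \<Rightarrow> ('s \<Rightarrow> real) \<Rightarrow> ('s \<Rightarrow> 'x \<Rightarrow> real) \<Rightarrow> ('x set \<Rightarrow> real) \<Rightarrow> 's set \<Rightarrow> 'x set \<Rightarrow> 'x set set \<Rightarrow> real"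
  where
  "max_ratio S c d f S' X' \<T> =
     Max (insert 0 {gain f X' T / c_min S c d S' T |T. T \<in> \<T> \<and> c_min S c d S' T > 0})"

definition alpha_list ::
    "'x set \<Rightarrow> 's set \<Rightarrow> ('s \<Rightarrow> real) \<Rightarrow> ('s \<Rightarrow> 'x \<Rightarrow> real) \<Rightarrow> real \<Rightarrow> ('x set \<Rightarrow> real) \<Rightarrow>
     's set \<Rightarrow> 'x set \<Rightarrow> ('x set \<Rightarrow> 's) \<Rightarrow> real \<Rightarrow> 'x set set \<Rightarrow> bool" where
  "alpha_list X S c d k f S' X' s_min \<alpha> L \<longleftrightarrow>
     L \<subseteq> feasible X c d S' X' s_min k \<and>
     max_ratio S c d f S' X' L \<ge> \<alpha> * max_ratio S c d f S' X' (feasible X c d S' X' s_min k)"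

text \<open>The smallest positive cost. If every cost is zero, this minimum is over the empty set; the
  value \<open>k\<close> then plays the role of infinity, i.e. the loop of the algorithm below is not entered.\<close>

definition c_hat :: "'x set \<Rightarrow> 's set \<Rightarrow> ('s \<Rightarrow> real) \<Rightarrow> ('s \<Rightarrow> 'x \<Rightarrow> real) \<Rightarrow> real \<Rightarrow> real" where
  "c_hat X S c d k =
     (let P = {c s |s. s \<in> S \<and> c s > 0} \<union> {d s x |s x. s \<in> S \<and> x \<in> X \<and> d s x > 0}
      in if P = {} then k else Min P)"

text \<open>The procedure is modelled by \<open>greedy s B\<close>, which must return a set with the stated guarantee
  whenever \<open>B \<ge> 0\<close>. For \<open>B < 0\<close> no set meets the knapsack constraint, so the first conjunct forces
  \<open>greedy s B = None\<close>. Since gains are only meant for sets of new elements, the returned set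
  avoids \<open>X'\<close>; the maximum it is compared with does not depend on whether \<open>T'\<close> may meet \<open>X'\<close>.\<close>

definition greedy_max_cover ::
    "'x set \<Rightarrow> 's set \<Rightarrow> ('s \<Rightarrow> 'x \<Rightarrow> real) \<Rightarrow> ('x set \<Rightarrow> real) \<Rightarrow> 'x set \<Rightarrow>
     ('s \<Rightarrow> real \<Rightarrow> 'x set option) \<Rightarrow> bool" where
  "greedy_max_cover X S d f X' greedy \<longleftrightarrow>
     (\<forall>s\<in>S. \<forall>B T. greedy s B = Some T \<longrightarrow>
        T \<subseteq> X - X' \<and> (\<Sum>x\<in>T. d s x) \<le> B \<and>
        gain f X' T \<ge>
          (1 - 1 / exp 1) * Max {gain f X' T' |T'. T' \<subseteq> X \<and> (\<Sum>x\<in>T'. d s x) \<le> B}) \<and>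
     (\<forall>s\<in>S. \<forall>B\<ge>0. greedy s B \<noteq> None)"

definition bin_loop ::
    "'x set \<Rightarrow> 's set \<Rightarrow> ('s \<Rightarrow> real) \<Rightarrow> ('s \<Rightarrow> 'x \<Rightarrow> real) \<Rightarrow> real \<Rightarrow> 's set \<Rightarrow>
     ('s \<Rightarrow> real \<Rightarrow> 'x set option) \<Rightarrow> real \<Rightarrow> 's \<Rightarrow> 'x set set" where
  "bin_loop X S c d k S' greedy \<epsilon> s =
     snd (while
       (\<lambda>(i, L). c_hat X S c d k * (1 + \<epsilon>) ^ i < k)
       (\<lambda>(i, L). (Suc i,
          L \<union> set_option (greedy s (c_hat X S c d k * (1 + \<epsilon>) ^ i - open_cost c S' s))))
       (0 :: nat, {}))
     \<union> set_option (greedy s (k - open_cost c S' s))"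

definition list_algorithm ::
    "'x set \<Rightarrow> 's set \<Rightarrow> ('s \<Rightarrow> real) \<Rightarrow> ('s \<Rightarrow> 'x \<Rightarrow> real) \<Rightarrow> real \<Rightarrow> 's set \<Rightarrow>
     ('s \<Rightarrow> real \<Rightarrow> 'x set option) \<Rightarrow> real \<Rightarrow> 'x set set" where
  "list_algorithm X S c d k S' greedy \<epsilon> = (\<Union>s\<in>S. bin_loop X S c d k S' greedy \<epsilon> s)"

end

theory Submission imports Defs begin

text \<open>
  Let \<open>T\<close> be a feasible set of best ratio. Assigning each element of \<open>T\<close> to its cheapest bin in
  \<open>S' \<union> {s_min T}\<close> splits \<open>T\<close> into parts whose additional costs sum to at most both \<open>c_min T\<close> and
  \<open>k\<close>; by submodularity their gains sum to at least the gain of \<open>T\<close>. Hence some part \<open>U\<close>, assigned to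
  a single bin \<open>s\<close> at cost \<open>A \<le> k\<close>, has at least the ratio of \<open>T\<close>. (The set \<open>T\<close> itself cannot be
  used, because feasibility does not imply \<open>c_min T \<le> k\<close>.) The algorithm tries some budget
  \<open>B\<close> with \<open>A \<le> B \<le> (1 + \<epsilon>) A\<close> for \<open>s\<close>, and the greedy set for this budget loses a
  factor \<open>1 - 1/e\<close> in the gain and \<open>1/(1 + \<epsilon>) \<ge> 1 - \<epsilon>\<close> in the cost.
\<close>

text \<open>Positivity of \<open>c_min\<close> is assumed for nonempty sets only: as soon as
  \<open>S'\<close> is nonempty, \<open>c_min\<close> of the empty set is 0, because a bin that is
  already open costs nothing more.\<close>

locale partial_solution =
  fixes X X' :: "'x set" and S S' :: "'s set"
    and c :: "'s \<Rightarrow> real" and d :: "'s \<Rightarrow> 'x \<Rightarrow> real"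
    and k :: real and f :: "'x set \<Rightarrow> real"
    and s_min :: "'x set \<Rightarrow> 's"
  assumes gbsm: "gbsm X S c d k f"
    and S'_subset: "S' \<subseteq> S" and X'_subset: "X' \<subseteq> X"
    and s_min: "is_s_min X S c d S' X' s_min"
    and c_min_pos: "\<And>T. T \<in> feasible X c d S' X' s_min k \<Longrightarrow> T \<noteq> {} \<Longrightarrow> c_min S c d S' T > 0"
begin

section \<open>Elementary properties of costs and gains\<close>

lemma finite_X: "finite X" and finite_S: "finite S"
  and c_nonneg: "s \<in> S \<Longrightarrow> c s \<ge> 0"
  and d_nonneg: "s \<in> S \<Longrightarrow> x \<in> X \<Longrightarrow> d s x \<ge> 0"
  and f_mono: "A \<subseteq> B \<Longrightarrow> B \<subseteq> X \<Longrightarrow> f A \<le> f B"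
  and f_submodular: "A \<subseteq> X \<Longrightarrow> B \<subseteq> X \<Longrightarrow> f (A \<union> B) + f (A \<inter> B) \<le> f A + f B"
  using gbsm unfolding gbsm_def by simp_all

lemma finite_S': "finite S'"
  using finite_S S'_subset by (rule finite_subset[rotated])

lemma s_min_in: "T \<subseteq> X - X' \<Longrightarrow> s_min T \<in> S"
  and add_cost_s_min: "T \<subseteq> X - X' \<Longrightarrow> add_cost c d S' (s_min T) T = c_min S c d S' T"
  using s_min unfolding is_s_min_def by simp_all

lemma open_cost_nonneg: "s \<in> S \<Longrightarrow> open_cost c S' s \<ge> 0"
  by (simp add: open_cost_def c_nonneg)

lemma sum_d_nonneg: "s \<in> S \<Longrightarrow> T \<subseteq> X \<Longrightarrow> (\<Sum>x\<in>T. d s x) \<ge> 0"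
  by (intro sum_nonneg d_nonneg) auto

lemma add_cost_nonneg: "s \<in> S \<Longrightarrow> T \<subseteq> X \<Longrightarrow> add_cost c d S' s T \<ge> 0"
  by (simp add: add_cost_def open_cost_nonneg sum_d_nonneg)

lemma c_min_le: "s \<in> S \<Longrightarrow> c_min S c d S' T \<le> add_cost c d S' s T"
  unfolding c_min_def using finite_S by (intro Min_le) auto

lemma gain_empty: "gain f X' {} = 0"
  by (simp add: gain_def)

lemma gain_nonneg: "T \<subseteq> X \<Longrightarrow> gain f X' T \<ge> 0"
  using f_mono[of X' "X' \<union> T"] X'_subset by (simp add: gain_def)

text \<open>Submodularity is applied to \<open>X' \<union> A\<close> and
  \<open>X' \<union> B\<close>. Their intersection contains \<open>X'\<close>, so by monotonicity
  its value may be replaced by \<open>f X'\<close>.\<close>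

lemma gain_Un_le:
  assumes "A \<subseteq> X" "B \<subseteq> X"
  shows "gain f X' (A \<union> B) \<le> gain f X' A + gain f X' B"
proof -
  have "f ((X' \<union> A) \<union> (X' \<union> B)) + f ((X' \<union> A) \<inter> (X' \<union> B)) \<le> f (X' \<union> A) + f (X' \<union> B)"
    using assms X'_subset by (intro f_submodular) auto
  moreover have "f X' \<le> f ((X' \<union> A) \<inter> (X' \<union> B))"
    using assms X'_subset by (intro f_mono) auto
  moreover have "(X' \<union> A) \<union> (X' \<union> B) = X' \<union> (A \<union> B)"
    by auto
  ultimately show ?thesis
    by (simp add: gain_def)
qed

lemma gain_UN_le:
  assumes "finite I" "\<And>i. i \<in> I \<Longrightarrow> A i \<subseteq> X"
  shows "gain f X' (\<Union>i\<in>I. A i) \<le> (\<Sum>i\<in>I. gain f X' (A i))"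
  using assms
proof (induction I rule: finite_induct)
  case empty
  show ?case by (simp add: gain_empty)
next
  case (insert i I)
  have "gain f X' (A i \<union> (\<Union>i\<in>I. A i)) \<le> gain f X' (A i) + gain f X' (\<Union>i\<in>I. A i)"
    using insert.prems by (intro gain_Un_le) auto
  with insert show ?case by fastforce
qed

section \<open>Total cost and feasibility\<close>

lemma sum_insert_open_cost: "(\<Sum>t\<in>insert s S'. c t) = (\<Sum>t\<in>S'. c t) + open_cost c S' s"
  using finite_S' by (simp add: open_cost_def sum.insert_if)

text \<open>Sending all of \<open>T\<close> to \<open>s\<close> is no cheaper than using the
  cheapest open bin for each element.\<close>

lemma total_cost_insert_le:
  "total_cost c d (S' \<union> {s}) T \<le> (\<Sum>t\<in>S'. c t) + add_cost c d S' s T"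
proof -
  have "(\<Sum>x\<in>T. Min ((\<lambda>t. d t x) ` insert s S')) \<le> (\<Sum>x\<in>T. d s x)"
    using finite_S' by (intro sum_mono Min_le) auto
  then show ?thesis
    by (simp add: total_cost_def add_cost_def sum_insert_open_cost del: image_insert)
qed

text \<open>The existence of a feasible set shows that the bins already open fit into the budget:
  all other terms of its total cost are nonnegative.\<close>

lemma sum_c_le_budget:
  assumes T: "T \<in> feasible X c d S' X' s_min k"
  shows "(\<Sum>s\<in>S'. c s) \<le> k"
proof -
  have TX: "T \<subseteq> X - X'" and Tk: "total_cost c d (insert (s_min T) S') T \<le> k"
    using T by (auto simp: feasible_def)
  have "Min ((\<lambda>s. d s x) ` insert (s_min T) S') \<ge> 0" if "x \<in> T" for x
    using finite_S' S'_subset TX s_min_in[OF TX] that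
    by (subst Min_ge_iff) (auto intro!: d_nonneg)
  then have "(\<Sum>x\<in>T. Min ((\<lambda>s. d s x) ` insert (s_min T) S')) \<ge> 0"
    by (intro sum_nonneg)
  with Tk open_cost_nonneg[OF s_min_in[OF TX]] show ?thesis
    by (simp add: total_cost_def sum_insert_open_cost del: image_insert)
qed

text \<open>Feasibility charges the bins of \<open>S'\<close> in full while \<open>c_min\<close>
  charges nothing for them; the sum added to the budget makes up for this.\<close>

lemma feasible_relaxed:
  assumes "T \<subseteq> X - X'" "c_min S c d S' T \<le> b"
  shows "T \<in> feasible X c d S' X' s_min (b + (\<Sum>s\<in>S'. c s))"
  using total_cost_insert_le[of "s_min T" T] assms add_cost_s_min[of T]
  by (simp add: feasible_def)

text \<open>This extends positivity to sets not known to be feasible, such as the parts of an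
  optimal set and the greedy sets: if \<open>c_min\<close> were not positive, the set would fit into
  the budget already needed for \<open>S'\<close>, hence be feasible after all.\<close>

lemma c_min_pos_of_sum_le:
  assumes "T \<subseteq> X - X'" "T \<noteq> {}" "(\<Sum>s\<in>S'. c s) \<le> k"
  shows "c_min S c d S' T > 0"
proof (rule ccontr)
  assume neg: "\<not> c_min S c d S' T > 0"
  then have "T \<in> feasible X c d S' X' s_min (0 + (\<Sum>s\<in>S'. c s))"
    by (intro feasible_relaxed assms) simp
  then have "T \<in> feasible X c d S' X' s_min k"
    using assms(3) by (simp add: feasible_def)
  with c_min_pos neg assms(2) show False by blast
qed

section \<open>Reduction to a set assigned to a single bin\<close>

lemma ex_single_bin_part:
  assumes T: "T \<in> feasible X c d S' X' s_min k"
    and cT: "c_min S c d S' T > 0" and gT: "gain f X' T > 0"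
  obtains s U where "s \<in> S" "U \<subseteq> X" "add_cost c d S' s U > 0" "add_cost c d S' s U \<le> k"
    "gain f X' T / c_min S c d S' T \<le> gain f X' U / add_cost c d S' s U"
proof -
  define I where "I = S' \<union> {s_min T}"
  define bin where "bin x = arg_min_on (\<lambda>s. d s x) I" for x
  define U where "U s = {x \<in> T. bin x = s}" for s
  let ?A = "\<lambda>s. add_cost c d S' s (U s)" and ?g = "gain f X'" and ?C = "c_min S c d S' T"
  have TX: "T \<subseteq> X - X'" and Tk: "total_cost c d I T \<le> k"
    using T by (auto simp: feasible_def I_def)
  have finI: "finite I" and neI: "I \<noteq> {}" and IS: "I \<subseteq> S"
    using finite_S' S'_subset s_min_in[OF TX] by (auto simp: I_def)
  have finT: "finite T"
    using TX finite_X finite_subset by blast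
  have bin_in: "bin x \<in> I" for x
    unfolding bin_def using finI neI by (rule arg_min_if_finite)
  have d_bin: "d (bin x) x = Min ((\<lambda>s. d s x) ` I)" for x
    using finI neI bin_in[of x] arg_min_least[OF finI neI, of _ "\<lambda>s. d s x"]
    by (intro Min_eqI[symmetric]) (auto simp: bin_def)
  have UT: "U s \<subseteq> T" for s
    by (auto simp: U_def)
  then have UX: "U s \<subseteq> X - X'" and UX': "U s \<subseteq> X" for s
    using TX by blast+
  have A_nonneg: "?A s \<ge> 0" if "s \<in> I" for s
    using IS that UX' by (intro add_cost_nonneg) auto
  have sum_A: "(\<Sum>s\<in>I. ?A s) = (\<Sum>s\<in>I. open_cost c S' s) + (\<Sum>x\<in>T. Min ((\<lambda>s. d s x) ` I))"
  proof -
    have "(\<Sum>s\<in>I. \<Sum>x\<in>U s. d s x) = (\<Sum>s\<in>I. \<Sum>x\<in>U s. d (bin x) x)"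
      by (simp add: U_def)
    also have "\<dots> = (\<Sum>x\<in>T. d (bin x) x)"
      unfolding U_def using finT finI bin_in by (intro sum.group) auto
    finally show ?thesis
      by (simp add: add_cost_def sum.distrib d_bin)
  qed
  \<comment> \<open>At most one bin of \<open>I\<close> still has to be paid for, namely
    \<open>s_min T\<close>.\<close>
  have sum_open: "(\<Sum>s\<in>I. open_cost c S' s) = open_cost c S' (s_min T)"
  proof -
    have "(\<Sum>s\<in>S'. open_cost c S' s) = 0"
      by (simp add: open_cost_def)
    then show ?thesis
      using finite_S' by (simp add: I_def sum.insert_if open_cost_def)
  qed
  have sum_A_le_C: "(\<Sum>s\<in>I. ?A s) \<le> ?C"
  proof -
    have "(\<Sum>x\<in>T. Min ((\<lambda>s. d s x) ` I)) \<le> (\<Sum>x\<in>T. d (s_min T) x)"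
      using finI by (intro sum_mono Min_le) (auto simp: I_def)
    then show ?thesis
      unfolding sum_A sum_open add_cost_s_min[OF TX, symmetric] by (simp add: add_cost_def)
  qed
  \<comment> \<open>Connection costs agree on both sides; only the bins of \<open>S'\<close> are
    charged differently, namely in full on the right.\<close>
  have "(\<Sum>s\<in>I. ?A s) \<le> total_cost c d I T"
    unfolding sum_A total_cost_def using IS
    by (intro add_right_mono sum_mono) (auto simp: open_cost_def c_nonneg)
  with Tk have sum_A_le_k: "(\<Sum>s\<in>I. ?A s) \<le> k"
    by simp
  have A_le_k: "?A s \<le> k" if "s \<in> I" for s
    using member_le_sum[of s I ?A] finI that A_nonneg sum_A_le_k by fastforce
  \<comment> \<open>A part without gain may be empty and cost nothing, so positivity is claimed only
    for parts with positive gain.\<close>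
  have A_pos: "?A s > 0" if "s \<in> I" "?g (U s) > 0" for s
  proof -
    have "U s \<noteq> {}"
      using that gain_empty by force
    then have "c_min S c d S' (U s) > 0"
      using UX sum_c_le_budget[OF T] by (intro c_min_pos_of_sum_le)
    also have "\<dots> \<le> ?A s"
      using IS that by (intro c_min_le) auto
    finally show ?thesis .
  qed
  have "T = (\<Union>s\<in>I. U s)"
    using bin_in by (auto simp: U_def)
  then have gT_le: "?g T \<le> (\<Sum>s\<in>I. ?g (U s))"
    using gain_UN_le[OF finI, of U] UX' by simp
  \<comment> \<open>An averaging argument, with ratios cross-multiplied because some
    \<open>?A s\<close> may vanish. If every part with positive gain had a smaller ratio than
    \<open>T\<close>, summing over \<open>I\<close> would contradict the bounds on total cost and
    total gain.\<close>
  have "\<exists>s\<in>I. ?g (U s) > 0 \<and> ?g T * ?A s \<le> ?g (U s) * ?C"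
  proof (rule ccontr)
    assume "\<not> ?thesis"
    then have strict: "?g (U s) * ?C < ?g T * ?A s" if "s \<in> I" "?g (U s) > 0" for s
      using that by force
    have weak: "?g (U s) * ?C \<le> ?g T * ?A s" if "s \<in> I" for s
    proof (cases "?g (U s) > 0")
      case False
      then have "?g (U s) = 0"
        using gain_nonneg[OF UX', of s] by simp
      with A_nonneg[OF that] gT show ?thesis by simp
    qed (use strict that in force)
    \<comment> \<open>The summed inequality is strict only if some part has positive gain.\<close>
    have "\<exists>s\<in>I. ?g (U s) > 0"
    proof (rule ccontr)
      assume "\<not> ?thesis"
      then have "(\<Sum>s\<in>I. ?g (U s)) \<le> 0"
        by (intro sum_nonpos) force
      with gT gT_le show False by simp
    qed
    then have "(\<Sum>s\<in>I. ?g (U s) * ?C) < (\<Sum>s\<in>I. ?g T * ?A s)"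
      using weak strict finI by (intro sum_strict_mono_ex1) auto
    also have "\<dots> = ?g T * (\<Sum>s\<in>I. ?A s)"
      by (simp add: sum_distrib_left)
    also have "\<dots> \<le> ?g T * ?C"
      using sum_A_le_C gT by simp
    also have "\<dots> \<le> (\<Sum>s\<in>I. ?g (U s)) * ?C"
      using gT_le cT by simp
    finally show False
      by (simp add: sum_distrib_right)
  qed
  then obtain s where s: "s \<in> I" "?g (U s) > 0" "?g T * ?A s \<le> ?g (U s) * ?C"
    by blast
  then have "?g T / ?C \<le> ?g (U s) / ?A s"
    using A_pos cT by (simp add: field_simps)
  then show ?thesis
    using that[of s "U s"] s IS UX' A_pos A_le_k by blast
qed

section \<open>Best ratio of a family\<close>

lemma ratio_le_max_ratio:
  assumes "finite \<T>" "T \<in> \<T>" "c_min S c d S' T > 0"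
  shows "gain f X' T / c_min S c d S' T \<le> max_ratio S c d f S' X' \<T>"
  unfolding max_ratio_def using assms by (intro Max_ge) auto

lemma max_ratio_nonneg: "finite \<T> \<Longrightarrow> max_ratio S c d f S' X' \<T> \<ge> 0"
  unfolding max_ratio_def by (intro Max_ge) auto

lemma max_ratio_cases:
  assumes "finite \<T>"
  obtains "max_ratio S c d f S' X' \<T> = 0"
  | T where "T \<in> \<T>" "c_min S c d S' T > 0"
      "max_ratio S c d f S' X' \<T> = gain f X' T / c_min S c d S' T"
proof -
  have "max_ratio S c d f S' X' \<T>
      \<in> insert 0 {gain f X' T / c_min S c d S' T |T. T \<in> \<T> \<and> c_min S c d S' T > 0}"
    unfolding max_ratio_def using assms by (intro Max_in) auto
  then show ?thesis
    using that by blast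
qed

section \<open>The smallest positive cost\<close>

abbreviation positive_costs :: "real set" where
  "positive_costs \<equiv>
     {c s |s. s \<in> S \<and> c s > 0} \<union> {d s x |s x. s \<in> S \<and> x \<in> X \<and> d s x > 0}"

lemma finite_positive_costs: "finite positive_costs"
  using finite_S finite_X finite_image_set2[of "\<lambda>s. s \<in> S" "\<lambda>x. x \<in> X" d]
  by (auto intro: finite_subset[of _ "{d s x |s x. s \<in> S \<and> x \<in> X}"])

lemma Min_positive_costs: "positive_costs \<noteq> {} \<Longrightarrow> Min positive_costs > 0"
  using finite_positive_costs by (subst Min_gr_iff) auto

text \<open>The second case covers the default value taken when no cost is positive;
  \<open>k\<close> may then be 0.\<close>

lemma c_hat_pos_or_k: "c_hat X S c d k > 0 \<or> c_hat X S c d k = k"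
  using Min_positive_costs unfolding c_hat_def Let_def by (simp only: split: if_split) blast

text \<open>A positive sum of nonnegative costs has a positive summand, which is at least the
  smallest positive cost. Hence the geometric budgets start no higher than the cost to be
  approximated.\<close>

lemma c_hat_le_add_cost:
  assumes "s \<in> S" "U \<subseteq> X" "add_cost c d S' s U > 0"
  shows "c_hat X S c d k \<le> add_cost c d S' s U"
proof -
  have finU: "finite U"
    using assms(2) finite_X finite_subset by blast
  have "\<exists>p\<in>positive_costs. p \<le> add_cost c d S' s U"
  proof (cases "open_cost c S' s > 0")
    case True
    then have "c s \<in> positive_costs" "c s \<le> add_cost c d S' s U"
      using assms(1) sum_d_nonneg[OF assms(1,2)]
      by (auto simp: add_cost_def open_cost_def split: if_splits)
    then show ?thesis by blast
  next
    case False
    then have "(\<Sum>x\<in>U. d s x) > 0"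
      using assms(3) by (simp add: add_cost_def)
    then obtain x where x: "x \<in> U" "d s x > 0"
      by (meson not_le sum_nonpos)
    then have "d s x \<le> (\<Sum>x\<in>U. d s x)"
      using finU assms(1,2) by (intro member_le_sum d_nonneg) auto
    then have "d s x \<le> add_cost c d S' s U"
      using open_cost_nonneg[OF assms(1)] by (simp add: add_cost_def)
    moreover have "d s x \<in> positive_costs"
      using x assms(1,2) by blast
    ultimately show ?thesis by blast
  qed
  then obtain p where p: "p \<in> positive_costs" "p \<le> add_cost c d S' s U" ..
  then have "positive_costs \<noteq> {}" by blast
  then have "c_hat X S c d k = Min positive_costs"
    unfolding c_hat_def Let_def by (rule if_not_P)
  also have "\<dots> \<le> p"
    using finite_positive_costs p(1) by (rule Min_le)
  finally show ?thesis
    using p(2) by simp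
qed

end

section \<open>Budgets tried for one bin\<close>

text \<open>The disjunction makes the loop terminate: the budgets grow without bound, or the loop is
  not entered.\<close>

lemma bin_loop_eq:
  fixes X :: "'x set"
  assumes "c_hat X S c d k > 0 \<or> c_hat X S c d k = k" "\<epsilon> > 0"
  obtains n where
    "\<not> c_hat X S c d k * (1 + \<epsilon>) ^ n < k"
    "\<And>i. i < n \<Longrightarrow> c_hat X S c d k * (1 + \<epsilon>) ^ i < k"
    "bin_loop X S c d k S' greedy \<epsilon> s =
       (\<Union>i<n. set_option (greedy s (c_hat X S c d k * (1 + \<epsilon>) ^ i - open_cost c S' s)))
       \<union> set_option (greedy s (k - open_cost c S' s))"
proof -
  define B where "B i = c_hat X S c d k * (1 + \<epsilon>) ^ i" for i
  define G where "G i = set_option (greedy s (B i - open_cost c S' s))" for i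
  define n where "n = (LEAST i. \<not> B i < k)"
  have "\<exists>i. \<not> B i < k"
  proof (cases "c_hat X S c d k = k")
    case True
    then have "\<not> B 0 < k" by (simp add: B_def)
    then show ?thesis ..
  next
    case False
    then have pos: "c_hat X S c d k > 0"
      using assms(1) by blast
    obtain i where "k / c_hat X S c d k < (1 + \<epsilon>) ^ i"
      using real_arch_pow[of "1 + \<epsilon>"] assms(2) by auto
    with pos have "\<not> B i < k"
      by (simp add: B_def field_simps)
    then show ?thesis ..
  qed
  then have n: "\<not> B n < k"
    unfolding n_def by (rule LeastI_ex)
  have below_n: "B i < k" if "i < n" for i
    using not_less_Least that unfolding n_def by blast
  \<comment> \<open>The bound \<open>i \<le> n\<close> in the invariant forces the exit to happen
    exactly at \<open>n\<close>: the test succeeds at every smaller index.\<close>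
  have "snd (while (\<lambda>(i, L). B i < k) (\<lambda>(i, L). (Suc i, L \<union> G i)) (0, {})) = (\<Union>i<n. G i)"
  proof (rule while_rule[where P = "\<lambda>(i, L). i \<le> n \<and> L = (\<Union>j<i. G j)"
        and r = "measure (\<lambda>(i, L). n - i)"])
    fix p
    assume P: "case p of (i, L) \<Rightarrow> i \<le> n \<and> L = (\<Union>j<i. G j)"
      and cond: "case p of (i, L) \<Rightarrow> B i < k"
    obtain i L where p: "p = (i, L)" by force
    have "i < n"
      using P cond n by (cases "i = n") (auto simp: p)
    then show "case case p of (i, L) \<Rightarrow> (Suc i, L \<union> G i) of (i, L) \<Rightarrow> i \<le> n \<and> L = (\<Union>j<i. G j)"
      and "(case p of (i, L) \<Rightarrow> (Suc i, L \<union> G i), p) \<in> measure (\<lambda>(i, L). n - i)"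
      using P by (auto simp: p lessThan_Suc)
  next
    fix p
    assume P: "case p of (i, L) \<Rightarrow> i \<le> n \<and> L = (\<Union>j<i. G j)"
      and cond: "\<not> (case p of (i, L) \<Rightarrow> B i < k)"
    obtain i L where p: "p = (i, L)" by force
    have "i = n"
      using P cond below_n[of i] by (cases "i < n") (auto simp: p)
    with P show "snd p = (\<Union>i<n. G i)"
      by (simp add: p)
  qed auto
  then have "bin_loop X S c d k S' greedy \<epsilon> s =
      (\<Union>i<n. G i) \<union> set_option (greedy s (k - open_cost c S' s))"
    unfolding bin_loop_def B_def G_def by simp
  with n below_n show ?thesis
    using that unfolding B_def G_def by blast
qed

text \<open>The first power reaching \<open>A\<close> overshoots by a factor of at most
  \<open>1 + \<epsilon>\<close>, because its predecessor is below \<open>A\<close>, or because it is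
  \<open>b\<close> itself and \<open>b \<le> A\<close>.\<close>

lemma ex_geometric_budget:
  fixes b A k \<epsilon> :: real
  assumes "\<epsilon> > 0" "b \<le> A" "0 < A" "A \<le> k" "\<not> b * (1 + \<epsilon>) ^ n < k"
  obtains B where "B = k \<or> (\<exists>i<n. B = b * (1 + \<epsilon>) ^ i)" "A \<le> B" "B \<le> (1 + \<epsilon>) * A"
proof -
  define m where "m = (LEAST i. A \<le> b * (1 + \<epsilon>) ^ i)"
  have An: "A \<le> b * (1 + \<epsilon>) ^ n"
    using assms by simp
  then have m: "A \<le> b * (1 + \<epsilon>) ^ m" and mn: "m \<le> n"
    unfolding m_def by (rule LeastI, rule Least_le)
  have upper: "b * (1 + \<epsilon>) ^ m \<le> (1 + \<epsilon>) * A"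
  proof (cases m)
    case 0
    have "1 * A \<le> (1 + \<epsilon>) * A"
      using assms by (intro mult_right_mono) auto
    with 0 assms(2) show ?thesis by simp
  next
    case (Suc j)
    then have "\<not> A \<le> b * (1 + \<epsilon>) ^ j"
      using not_less_Least[of j "\<lambda>i. A \<le> b * (1 + \<epsilon>) ^ i"] by (simp add: m_def)
    then have "(1 + \<epsilon>) * (b * (1 + \<epsilon>) ^ j) \<le> (1 + \<epsilon>) * A"
      using assms by (intro mult_left_mono) auto
    then show ?thesis
      by (simp add: Suc mult.left_commute)
  qed
  show ?thesis
  proof (cases "m < n")
    case True
    then show ?thesis
      using that[of "b * (1 + \<epsilon>) ^ m"] m upper by blast
  next
    \<comment> \<open>The budget with exponent \<open>n\<close> is not tried by the loop. The final
      budget \<open>k\<close> replaces it, lying between \<open>A\<close> and that power.\<close>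
    case False
    with mn have "m = n" by simp
    then show ?thesis
      using that[of k] upper assms by simp
  qed
qed

section \<open>Guarantee for the returned list\<close>

context partial_solution
begin

text \<open>Every budget tried is at most \<open>k\<close>, and the greedy set together with the
  opening cost of its bin stays within that budget. The bins of \<open>S'\<close> are not charged
  here, so this yields feasibility only for a budget enlarged by their cost.\<close>

lemma list_algorithm_memD:
  assumes greedy: "greedy_max_cover X S d f X' greedy" and "\<epsilon> > 0"
    and T: "T \<in> list_algorithm X S c d k S' greedy \<epsilon>"
  shows "T \<subseteq> X - X'" "c_min S c d S' T \<le> k"
proof -
  obtain s where s: "s \<in> S" "T \<in> bin_loop X S c d k S' greedy \<epsilon> s"
    using T unfolding list_algorithm_def by blast
  obtain n where n: "\<And>i. i < n \<Longrightarrow> c_hat X S c d k * (1 + \<epsilon>) ^ i < k"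
    "bin_loop X S c d k S' greedy \<epsilon> s =
       (\<Union>i<n. set_option (greedy s (c_hat X S c d k * (1 + \<epsilon>) ^ i - open_cost c S' s)))
       \<union> set_option (greedy s (k - open_cost c S' s))"
    using bin_loop_eq[OF c_hat_pos_or_k \<open>\<epsilon> > 0\<close>] by metis
  have "\<exists>B\<le>k. greedy s (B - open_cost c S' s) = Some T"
    using s(2) unfolding n(2) by (auto intro: less_imp_le n(1))
  then obtain B where B: "B \<le> k" "greedy s (B - open_cost c S' s) = Some T"
    by blast
  then have *: "T \<subseteq> X - X'" "(\<Sum>x\<in>T. d s x) \<le> B - open_cost c S' s"
    using greedy s(1) unfolding greedy_max_cover_def by blast+
  show "T \<subseteq> X - X'" by fact
  show "c_min S c d S' T \<le> k"
    using c_min_le[OF s(1), of T] * B(1) by (simp add: add_cost_def)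
qed

lemma ex_list_algorithm_approx:
  assumes greedy: "greedy_max_cover X S d f X' greedy" and "\<epsilon> > 0"
    and sU: "s \<in> S" "U \<subseteq> X" "add_cost c d S' s U > 0" "add_cost c d S' s U \<le> k"
  obtains T where "T \<in> list_algorithm X S c d k S' greedy \<epsilon>"
    "c_min S c d S' T \<le> (1 + \<epsilon>) * add_cost c d S' s U"
    "gain f X' T \<ge> (1 - 1 / exp 1) * gain f X' U"
proof -
  obtain n where n: "\<not> c_hat X S c d k * (1 + \<epsilon>) ^ n < k"
    "bin_loop X S c d k S' greedy \<epsilon> s =
       (\<Union>i<n. set_option (greedy s (c_hat X S c d k * (1 + \<epsilon>) ^ i - open_cost c S' s)))
       \<union> set_option (greedy s (k - open_cost c S' s))"
    using bin_loop_eq[OF c_hat_pos_or_k \<open>\<epsilon> > 0\<close>] by metis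
  obtain B where B: "B = k \<or> (\<exists>i<n. B = c_hat X S c d k * (1 + \<epsilon>) ^ i)"
    "add_cost c d S' s U \<le> B" "B \<le> (1 + \<epsilon>) * add_cost c d S' s U"
    using ex_geometric_budget[OF \<open>\<epsilon> > 0\<close> c_hat_le_add_cost[OF sU(1-3)] sU(3,4) n(1)] by metis
  let ?b = "B - open_cost c S' s"
  have U_le: "(\<Sum>x\<in>U. d s x) \<le> ?b"
    using B(2) by (simp add: add_cost_def)
  \<comment> \<open>A nonnegative remaining budget guarantees that the greedy procedure returns a
    set.\<close>
  then have "?b \<ge> 0"
    using sum_d_nonneg[OF sU(1,2)] by simp
  then obtain T where T: "greedy s ?b = Some T"
    using greedy sU(1) unfolding greedy_max_cover_def by blast
  then have T': "(\<Sum>x\<in>T. d s x) \<le> ?b"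
    and gT: "gain f X' T \<ge> (1 - 1 / exp 1) * Max {gain f X' T' |T'. T' \<subseteq> X \<and> (\<Sum>x\<in>T'. d s x) \<le> ?b}"
    using greedy sU(1) unfolding greedy_max_cover_def by blast+
  have "T \<in> bin_loop X S c d k S' greedy \<epsilon> s"
    using B(1) T unfolding n(2) by auto
  then have "T \<in> list_algorithm X S c d k S' greedy \<epsilon>"
    using sU(1) unfolding list_algorithm_def by blast
  moreover have "c_min S c d S' T \<le> (1 + \<epsilon>) * add_cost c d S' s U"
    using c_min_le[OF sU(1), of T] T' B(3) by (simp add: add_cost_def)
  \<comment> \<open>\<open>U\<close> itself competes in the knapsack problem for this
    budget.\<close>
  moreover have "gain f X' U \<le> Max {gain f X' T' |T'. T' \<subseteq> X \<and> (\<Sum>x\<in>T'. d s x) \<le> ?b}"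
    using finite_X U_le sU(2) by (intro Max_ge) auto
  then have "(1 - 1 / exp 1) * gain f X' U \<le> gain f X' T"
    using gT by (elim order_trans[OF mult_left_mono]) auto
  ultimately show ?thesis
    using that by blast
qed

lemma finite_feasible: "finite (feasible X c d S' X' s_min b)"
  by (rule finite_subset[of _ "Pow X"]) (auto simp: feasible_def finite_X)

theorem list_algorithm_max_ratio:
  assumes greedy: "greedy_max_cover X S d f X' greedy" and \<epsilon>: "0 < \<epsilon>" "\<epsilon> < 1"
  shows "(1 - 1 / exp 1) * (1 - \<epsilon>) * max_ratio S c d f S' X' (feasible X c d S' X' s_min k)
    \<le> max_ratio S c d f S' X' (list_algorithm X S c d k S' greedy \<epsilon>)"
    (is "?\<alpha> * ?r \<le> max_ratio S c d f S' X' ?L")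
proof -
  have finL: "finite ?L"
    using list_algorithm_memD(1)[OF greedy \<epsilon>(1)] finite_X
    by (intro finite_subset[of ?L "Pow X"]) auto
  let ?e = "1 - 1 / exp (1::real)"
  have e: "?e > 0" by simp
  show ?thesis
  proof (cases "?r > 0")
    case False
    then have "?\<alpha> * ?r \<le> 0"
      using \<epsilon> e by (intro mult_nonneg_nonpos) auto
    with max_ratio_nonneg[OF finL] show ?thesis by linarith
  next
    case True
    then obtain T where T: "T \<in> feasible X c d S' X' s_min k" "c_min S c d S' T > 0"
      "?r = gain f X' T / c_min S c d S' T"
      using max_ratio_cases[OF finite_feasible[of k]] by (metis less_irrefl)
    with True have gT: "gain f X' T > 0"
      by (simp add: zero_less_divide_iff)
    obtain s U where sU: "s \<in> S" "U \<subseteq> X" "add_cost c d S' s U > 0" "add_cost c d S' s U \<le> k"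
      and ratio: "?r \<le> gain f X' U / add_cost c d S' s U"
      using ex_single_bin_part[OF T(1,2) gT] T(3) by metis
    let ?A = "add_cost c d S' s U"
    obtain V where V: "V \<in> ?L" "c_min S c d S' V \<le> (1 + \<epsilon>) * ?A" "gain f X' V \<ge> ?e * gain f X' U"
      using ex_list_algorithm_approx[OF greedy \<epsilon>(1) sU] by metis
    have rA: "?r * ?A \<le> gain f X' U"
      using ratio sU(3) by (simp add: field_simps)
    have "gain f X' U > 0"
      using rA True sU(3) by (meson less_le_trans mult_pos_pos)
    then have gV: "gain f X' V > 0"
      using V(3) e by (meson less_le_trans mult_pos_pos)
    \<comment> \<open>Positive gain excludes the empty set, so \<open>c_min\<close> of
      \<open>V\<close> is positive and the ratio of \<open>V\<close> counts in the maximum.\<close>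
    then have "V \<noteq> {}"
      using gain_empty by force
    then have cV: "c_min S c d S' V > 0"
      using list_algorithm_memD(1)[OF greedy \<epsilon>(1) V(1)] sum_c_le_budget[OF T(1)]
      by (intro c_min_pos_of_sum_le)
    \<comment> \<open>The loss in cost is absorbed by
      \<open>(1 - \<epsilon>) * (1 + \<epsilon>) = 1 - \<epsilon>\<^sup>2\<close>, which is at most
      1.\<close>
    have "?\<alpha> * ?r * c_min S c d S' V \<le> ?\<alpha> * ?r * ((1 + \<epsilon>) * ?A)"
      using V(2) True \<epsilon> e by (intro mult_left_mono) auto
    also have "\<dots> = (1 - \<epsilon>\<^sup>2) * (?e * (?r * ?A))"
      by (simp add: power2_eq_square algebra_simps)
    also have "\<dots> \<le> 1 * (?e * (?r * ?A))"
      using True sU(3) e by (intro mult_right_mono) auto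
    also have "\<dots> \<le> ?e * gain f X' U"
      using rA e by simp
    also have "\<dots> \<le> gain f X' V" by fact
    finally have "?\<alpha> * ?r \<le> gain f X' V / c_min S c d S' V"
      using cV by (simp add: pos_le_divide_eq)
    also have "\<dots> \<le> max_ratio S c d f S' X' ?L"
      using finL V(1) cV by (rule ratio_le_max_ratio)
    finally show ?thesis .
  qed
qed

end

text \<open>The algorithm bounds additional costs by \<open>k\<close>, whereas
  \<open>feasible\<close> also counts the bins of \<open>S'\<close>. Therefore the ratio bound holds
  in every case, membership is stated for the enlarged budget, and the full
  \<open>alpha_list\<close> property is concluded when the bins of \<open>S'\<close> cost nothing in
  total.\<close>

theorem theorem3:
  fixes X X' :: "'x set" and S S' :: "'s set"
    and c :: "'s \<Rightarrow> real" and d :: "'s \<Rightarrow> 'x \<Rightarrow> real"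
    and k \<epsilon> \<alpha> :: real and f :: "'x set \<Rightarrow> real"
    and s_min :: "'x set \<Rightarrow> 's"
    and greedy :: "'s \<Rightarrow> real \<Rightarrow> 'x set option"
    and L :: "'x set set"
  assumes "gbsm X S c d k f"
    and "S' \<subseteq> S" and "X' \<subseteq> X"
    and "is_s_min X S c d S' X' s_min"
    and "\<forall>T \<in> feasible X c d S' X' s_min k. T \<noteq> {} \<longrightarrow> c_min S c d S' T > 0"
    and "0 < \<epsilon>" and "\<epsilon> < 1"
    and "greedy_max_cover X S d f X' greedy"
    and "L = list_algorithm X S c d k S' greedy \<epsilon>"
    and "\<alpha> = (1 - 1 / exp 1) * (1 - \<epsilon>)"
  shows "max_ratio S c d f S' X' L \<ge>
           \<alpha> * max_ratio S c d f S' X' (feasible X c d S' X' s_min k)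
       \<and> L \<subseteq> feasible X c d S' X' s_min (k + (\<Sum>s\<in>S'. c s))
       \<and> ((\<Sum>s\<in>S'. c s) = 0 \<longrightarrow> alpha_list X S c d k f S' X' s_min \<alpha> L)"
proof -
  interpret partial_solution X X' S S' c d k f s_min
    using assms(1-5) by unfold_locales auto
  have ratio: "max_ratio S c d f S' X' L \<ge>
      \<alpha> * max_ratio S c d f S' X' (feasible X c d S' X' s_min k)"
    unfolding assms(9,10) using assms(8,6,7) by (rule list_algorithm_max_ratio)
  moreover have sub: "L \<subseteq> feasible X c d S' X' s_min (k + (\<Sum>s\<in>S'. c s))"
    unfolding assms(9) using list_algorithm_memD[OF assms(8,6)] by (blast intro: feasible_relaxed)
  moreover have "L \<subseteq> feasible X c d S' X' s_min k" if "(\<Sum>s\<in>S'. c s) = 0"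
    using sub that by simp
  ultimately show ?thesis
    by (simp add: alpha_list_def)
qed

end
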